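(* Let $d,N,\beta\in\mathbb{N}$ with $\beta\ge N$, let $\mathcal{P} = (p_j)_{j = 1}^N$ be a generalized stratified sampling in $[0,1)^d$ associated with a partition $(B_j)_{j=1}^\beta$ of $[0,1)^d$ into measurable sets of Lebesgue measure $1/\beta$, and let $A \subseteq [0,1)^d$ be measurable. Then for every $1 \leq t \leq N$ $$\mathbf{P}\left(\bigcap_{j = 1}^t \{ p_j \in A\}\right) \leq \prod_{j = 1}^t \mathbf{P}(p_j \in A).$$ In particular, generalized stratified sampling is $\mathcal{S}$-negatively dependent for any system $\mathcal{S}$ of measurable subsets of $[0,1)^d$.
   Context: $[m]=\{1,\ldots,m\}$, $\lambda^d$ is $d$-dimensional Lebesgue measure, $\mathbf{1}_Q$ is the indicator function of $Q$, and $\mathbf{P}$ is the underlying probability measure. Generalized stratified sampling: partition $[0,1)^d$ into $\beta\ge N$ measurable sets $(B_j)_{j=1}^\beta$ (strata) with $\lambda^d(B_j)=1/\beta$ for all $j$. Let $Y=(Y_1,\ldots,Y_\beta)$ be uniformly distributed on $\{(v_1,\ldots,v_\beta)\in\{0,1\}^\beta : \sum_{j=1}^\beta v_j=N\}$. Given the value of $Y$, for each $j\in[\beta]$ with $Y_j=1$ place one point uniformly distributed in $B_j$, independently of all other points. This gives $N$ points; symmetrize, i.e. order them by an independent uniformly random permutation of $[N]$, to obtain $\mathcal{P}=(p_j)_{j=1}^N$. (Each $p_j$ is then uniformly distributed in $[0,1)^d$ and $(p_1,\ldots,p_N)$ is exchangeable.) $\mathcal{S}$-negative dependence: $(p_j)_{j=1}^N$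 is $\mathcal{S}$-negatively dependent if for every $Q\in\mathcal{S}$ the variables $T_j=\mathbf{1}_Q(p_j)$, $j\in[N]$, satisfy for all $u\subseteq[N]$ both $\mathbf{P}(\bigcap_{j\in u}\{T_j=1\})\le\prod_{j\in u}\mathbf{P}(T_j=1)$ and $\mathbf{P}(\bigcap_{j\in u}\{T_j=0\})\le\prod_{j\in u}\mathbf{P}(T_j=0)$. *)

theory Defs
  imports "HOL-Probability.Probability" "HOL-Combinatorics.Permutations"
begin

definition half_open_cube :: "(real ^ 'd) set" where
  "half_open_cube = {x. \<forall>i. 0 \<le> x $ i \<and> x $ i < 1}"

text \<open>
  Throughout, ``measurable'' means Lebesgue measurable (not just Borel), both for subsets of
  the cube and for random points.  Strata, points and slots are numbered from 1.
\<close>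

definition equal_volume_partition :: "nat \<Rightarrow> (nat \<Rightarrow> (real ^ 'd) set) \<Rightarrow> bool" where
  "equal_volume_partition \<beta> B \<longleftrightarrow>
     (\<Union>j\<in>{1..\<beta>}. B j) = half_open_cube \<and>
     disjoint_family_on B {1..\<beta>} \<and>
     (\<forall>j\<in>{1..\<beta>}. B j \<in> sets lebesgue \<and> measure lebesgue (B j) = 1 / real \<beta>)"

definition selections :: "nat \<Rightarrow> nat \<Rightarrow> (nat \<Rightarrow> nat) set" where
  "selections \<beta> N = {v \<in> {1..\<beta>} \<rightarrow>\<^sub>E {0, 1}. (\<Sum>j\<in>{1..\<beta>}. v j) = N}"

definition selected :: "nat \<Rightarrow> (nat \<Rightarrow> nat) \<Rightarrow> nat set" where
  "selected \<beta> v = {j \<in> {1..\<beta>}. v j = 1}"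

text \<open>The \<open>k\<close>-th selected stratum in increasing order, for \<open>k\<close> from 1 to the number of selected strata.\<close>

definition nth_selected :: "nat \<Rightarrow> (nat \<Rightarrow> nat) \<Rightarrow> nat \<Rightarrow> nat" where
  "nth_selected \<beta> v k = sorted_list_of_set (selected \<beta> v) ! (k - 1)"

text \<open>
  \<open>X j\<close> is the point placed in stratum \<open>j\<close>.  The conditions on it concern only the
  events \<open>Y = v\<close> with \<open>v j = 1\<close>; elsewhere \<open>X j\<close> is a dummy that never enters \<open>p\<close>.
  Conditioning on \<open>Y = v\<close> is \<^term>\<open>uniform_measure M {\<omega> \<in> space M. Y \<omega> = v}\<close>, since
  that measure sends \<open>E\<close> to the probability of \<open>E \<inter> {Y = v}\<close> divided by that of \<open>{Y = v}\<close>.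
  The points before symmetrization are \<open>q 1, \<dots>, q N\<close>, listed by increasing stratum index;
  \<open>\<pi>\<close> is independent of the pair formed by \<open>Y\<close> and these points, expressed as independence of
  the generated sigma-algebras because \<^const>\<open>prob_space.indep_var\<close> requires both
  variables to take values in the same type.
\<close>

definition generalized_stratified_sampling ::
  "'o measure \<Rightarrow> nat \<Rightarrow> nat \<Rightarrow> (nat \<Rightarrow> (real ^ 'd) set) \<Rightarrow> (nat \<Rightarrow> 'o \<Rightarrow> real ^ 'd) \<Rightarrow> bool" where
  "generalized_stratified_sampling M N \<beta> B p \<longleftrightarrow>
     prob_space M \<and>
     (\<exists>(Y :: 'o \<Rightarrow> nat \<Rightarrow> nat) (X :: nat \<Rightarrow> 'o \<Rightarrow> real ^ 'd) (\<pi> :: 'o \<Rightarrow> nat \<Rightarrow> nat).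
        let q = (\<lambda>k \<omega>. X (nth_selected \<beta> (Y \<omega>) k) \<omega>);
            perms = {\<sigma>. \<sigma> permutes {1..N}}
        in
        Y \<in> measurable M (count_space (selections \<beta> N)) \<and>
        distr M (count_space (selections \<beta> N)) Y = uniform_count_measure (selections \<beta> N) \<and>
        (\<forall>j\<in>{1..\<beta>}. X j \<in> measurable M lebesgue) \<and>
        (\<forall>v\<in>selections \<beta> N.
           let Mv = uniform_measure M {\<omega> \<in> space M. Y \<omega> = v}
           in prob_space.indep_vars Mv (\<lambda>_. lebesgue) X (selected \<beta> v) \<and>
              (\<forall>j\<in>selected \<beta> v. distr Mv lebesgue (X j) = uniform_measure lebesgue (B j))) \<and>
        \<pi> \<in> measurable M (count_space perms) \<and>
        distr M (count_space perms) \<pi> = uniform_count_measure perms \<and>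
        prob_space.indep_set M
          (sets (vimage_algebra (space M) \<pi> (count_space perms)))
          (sets (vimage_algebra (space M) (\<lambda>\<omega>. (Y \<omega>, \<lambda>k\<in>{1..N}. q k \<omega>))
             (count_space (selections \<beta> N) \<Otimes>\<^sub>M (\<Pi>\<^sub>M k\<in>{1..N}. lebesgue)))) \<and>
        (\<forall>k\<in>{1..N}. \<forall>\<omega>\<in>space M. p k \<omega> = q (\<pi> \<omega> k) \<omega>))"

definition negatively_dependent ::
  "'o measure \<Rightarrow> (real ^ 'd) set set \<Rightarrow> nat \<Rightarrow> (nat \<Rightarrow> 'o \<Rightarrow> real ^ 'd) \<Rightarrow> bool" where
  "negatively_dependent M \<S> N p \<longleftrightarrow>
     (\<forall>Q\<in>\<S>.
        let T = (\<lambda>j \<omega>. indicator Q (p j \<omega>) :: real)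
        in \<forall>u\<subseteq>{1..N}.
             measure M {\<omega> \<in> space M. \<forall>j\<in>u. T j \<omega> = 1}
               \<le> (\<Prod>j\<in>u. measure M {\<omega> \<in> space M. T j \<omega> = 1}) \<and>
             measure M {\<omega> \<in> space M. \<forall>j\<in>u. T j \<omega> = 0}
               \<le> (\<Prod>j\<in>u. measure M {\<omega> \<in> space M. T j \<omega> = 0}))"

end

theory Submission
  imports Defs
begin

text \<open>
  Write \<open>a\<^sub>i\<close> for the probability that a uniform point of the stratum \<open>B\<^sub>i\<close> falls into \<open>A\<close>.
  The strata of any \<open>t\<close> of the points form a uniformly random \<open>t\<close>-subset of all strata, so these
  points all lie in \<open>A\<close> with probability \<open>e\<^sub>t(a)\<close> divided by \<open>\<beta>\<close> choose \<open>t\<close>, where \<open>e\<^sub>t\<close> is the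
  elementary symmetric polynomial.  For \<open>t = 1\<close> this is the mean of the \<open>a\<^sub>i\<close>, and the claim
  becomes Maclaurin's inequality.  Since only \<open>a\<^sub>i \<ge> 0\<close> matters, \<open>A\<close> may be any measurable set, in
  particular the complement of a test set, which gives the second half of negative dependence.

  Maclaurin's inequality follows by induction on \<open>t\<close> from Chebyshev's sum inequality, since
  \<open>(t + 1) e\<^bsub>t+1\<^esub>\<close> is the sum of \<open>a\<^sub>i\<close> times \<open>e\<^sub>t\<close> of the other variables, and the second factor
  decreases as \<open>a\<^sub>i\<close> increases.
\<close>


section \<open>Elementary symmetric polynomials and their deletion identities\<close>

text \<open>The index set is an argument, so that deleting a variable amounts to shrinking
  \<open>S\<close>.\<close>

definition elem_sym :: "('a \<Rightarrow> real) \<Rightarrow> 'a set \<Rightarrow> nat \<Rightarrow> real" where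
  "elem_sym a S t = (\<Sum>T | T \<subseteq> S \<and> card T = t. \<Prod>i\<in>T. a i)"

lemma finite_subsets_card: "finite S \<Longrightarrow> finite {T. T \<subseteq> S \<and> card T = t}"
  by (rule finite_subset[of _ "Pow S"]) auto

lemma elem_sym_0 [simp]:
  assumes "finite S"
  shows "elem_sym a S 0 = 1"
proof -
  have "{T. T \<subseteq> S \<and> card T = 0} = {{}}"
    using assms by (auto dest: finite_subset)
  then show ?thesis by (simp add: elem_sym_def del: card_eq_0_iff)
qed

lemma elem_sym_1:
  assumes "finite S"
  shows "elem_sym a S 1 = sum a S"
proof -
  have "{T. T \<subseteq> S \<and> card T = 1} = (\<lambda>i. {i}) ` S"
    by (auto simp: card_1_singleton_iff)
  then show ?thesis
    unfolding elem_sym_def by (simp add: sum.reindex)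
qed

lemma elem_sym_nonneg: "(\<And>i. i \<in> S \<Longrightarrow> 0 \<le> a i) \<Longrightarrow> 0 \<le> elem_sym a S t"
  unfolding elem_sym_def by (intro sum_nonneg prod_nonneg) auto

text \<open>Pascal-type recurrence: a \<open>Suc t\<close>-subset of \<open>insert i S\<close>
  either avoids \<open>i\<close>, or is \<open>insert i T\<close> for a unique
  \<open>t\<close>-subset \<open>T\<close> of \<open>S\<close>.\<close>

lemma elem_sym_insert:
  assumes "finite S" "i \<notin> S"
  shows "elem_sym a (insert i S) (Suc t) = elem_sym a S (Suc t) + a i * elem_sym a S t"
proof -
  let ?P = "\<lambda>t. {T. T \<subseteq> S \<and> card T = t}"
  have "{T. T \<subseteq> insert i S \<and> card T = Suc t} = ?P (Suc t) \<union> insert i ` ?P t" (is "?L = ?R")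
  proof
    show "?R \<subseteq> ?L"
      using assms by (auto, subst card_insert_disjoint) (auto dest: finite_subset)
    show "?L \<subseteq> ?R"
    proof
      fix T assume T: "T \<in> ?L"
      then have "finite T" using assms finite_subset by auto
      show "T \<in> ?R"
      proof (cases "i \<in> T")
        case True
        then have "T = insert i (T - {i})" "T - {i} \<in> ?P t"
          using T \<open>finite T\<close> by auto
        then show ?thesis by blast
      qed (use T in auto)
    qed
  qed
  moreover have "?P (Suc t) \<inter> insert i ` ?P t = {}"
    using assms by auto
  moreover have "inj_on (insert i) (?P t)"
    using assms by (intro inj_onI) (metis (no_types, lifting) insert_ident mem_Collect_eq subsetD)
  moreover have "(\<Prod>k\<in>insert i T. a k) = a i * (\<Prod>k\<in>T. a k)" if "T \<in> ?P t" for T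
    using that assms by (subst prod.insert) (auto dest: finite_subset)
  ultimately show ?thesis
    using assms
    by (simp add: elem_sym_def sum.union_disjoint finite_subsets_card sum.reindex sum_distrib_left)
qed

text \<open>Double counting of pairs \<open>(T, i)\<close> with \<open>i\<close> in the
  \<open>Suc t\<close>-subset \<open>T\<close>: on the left such a pair is built by inserting
  \<open>i\<close> into a \<open>t\<close>-subset avoiding it, and each \<open>T\<close> arises once
  for each of its \<open>Suc t\<close> elements.\<close>

lemma sum_mult_elem_sym_remove:
  assumes "finite S"
  shows "(\<Sum>i\<in>S. a i * elem_sym a (S - {i}) t) = real (Suc t) * elem_sym a S (Suc t)"
proof -
  let ?P = "\<lambda>S t. {T. T \<subseteq> S \<and> card T = t}"
  have fin: "finite T" if "T \<subseteq> S" for T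
    using assms that finite_subset by blast
  have "(\<Sum>i\<in>S. a i * elem_sym a (S - {i}) t)
      = (\<Sum>i\<in>S. \<Sum>T\<in>?P (S - {i}) t. \<Prod>k\<in>insert i T. a k)"
    unfolding elem_sym_def sum_distrib_left
    by (intro sum.cong refl, subst prod.insert) (auto intro: fin)
  also have "\<dots> = (\<Sum>(i, T)\<in>Sigma S (\<lambda>i. ?P (S - {i}) t). \<Prod>k\<in>insert i T. a k)"
    using assms by (intro sum.Sigma) (auto intro: finite_subsets_card)
  also have "\<dots> = (\<Sum>(T, i)\<in>Sigma (?P S (Suc t)) (\<lambda>T. T). \<Prod>k\<in>T. a k)"
  proof (rule sum.reindex_bij_witness[where
        i = "\<lambda>(T, i). (i, T - {i})" and j = "\<lambda>(i, T). (insert i T, i)"], goal_cases)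
    case (2 x)
    then show ?case
      by (auto, subst card_insert_disjoint) (auto intro: fin)
  next
    case (4 x)
    then show ?case by (auto dest: fin)
  qed auto
  also have "\<dots> = (\<Sum>T\<in>?P S (Suc t). \<Sum>i\<in>T. \<Prod>k\<in>T. a k)"
    using assms by (intro sum.Sigma[symmetric]) (auto intro: finite_subsets_card fin)
  finally show ?thesis
    by (simp add: elem_sym_def sum_distrib_left)
qed

text \<open>Double counting again, now of pairs with \<open>i\<close> outside the
  \<open>t\<close>-subset \<open>T\<close>: each \<open>T\<close> survives the deletion of exactly
  the \<open>card S - t\<close> elements it does not contain. The subtraction is in the reals; for
  \<open>t > card S\<close> both sides vanish.\<close>

lemma sum_elem_sym_remove:
  assumes "finite S"
  shows "(\<Sum>i\<in>S. elem_sym a (S - {i}) t) = (real (card S) - real t) * elem_sym a S t"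
proof -
  let ?P = "{T. T \<subseteq> S \<and> card T = t}"
  have "(\<Sum>i\<in>S. elem_sym a (S - {i}) t) = (\<Sum>i\<in>S. \<Sum>T | T \<in> ?P \<and> i \<notin> T. \<Prod>k\<in>T. a k)"
    unfolding elem_sym_def by (intro sum.cong refl) auto
  also have "\<dots> = (\<Sum>T\<in>?P. \<Sum>i | i \<in> S \<and> i \<notin> T. \<Prod>k\<in>T. a k)"
    using assms by (intro sum.swap_restrict finite_subsets_card)
  also have "\<dots> = (\<Sum>T\<in>?P. (real (card S) - real t) * (\<Prod>k\<in>T. a k))"
  proof (intro sum.cong refl)
    fix T assume "T \<in> ?P"
    moreover have "{i. i \<in> S \<and> i \<notin> T} = S - T" by auto
    ultimately show "(\<Sum>i | i \<in> S \<and> i \<notin> T. \<Prod>k\<in>T. a k) = (real (card S) - real t) * (\<Prod>k\<in>T. a k)"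
      using assms by (auto simp: card_Diff_subset finite_subset of_nat_diff card_mono)
  qed
  finally show ?thesis
    by (simp add: elem_sym_def sum_distrib_left)
qed

text \<open>The monotonicity hypothesis for Chebyshev's inequality. Both deletions contain
  \<open>S - {i, j}\<close>; expanding each in its one further variable cancels the common term and
  leaves \<open>a j - a i\<close> times a nonnegative polynomial in the remaining variables.\<close>

lemma elem_sym_remove_opposite:
  assumes "finite S" "\<And>i. i \<in> S \<Longrightarrow> 0 \<le> a i" "i \<in> S" "j \<in> S"
  shows "(a i - a j) * (elem_sym a (S - {i}) t - elem_sym a (S - {j}) t) \<le> 0"
proof (cases "i = j \<or> t = 0")
  case False
  then obtain s where t: "t = Suc s" and "i \<noteq> j" by (cases t) auto
  let ?R = "S - {i, j}"
  have R: "S - {i} = insert j ?R" "S - {j} = insert i ?R"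
    using assms \<open>i \<noteq> j\<close> by auto
  have "elem_sym a (insert k ?R) t = elem_sym a ?R t + a k * elem_sym a ?R s" if "k \<in> {i, j}" for k
    using assms that unfolding t by (intro elem_sym_insert) auto
  then have diff: "elem_sym a (S - {i}) t - elem_sym a (S - {j}) t = (a j - a i) * elem_sym a ?R s"
    unfolding R by (simp add: left_diff_distrib)
  have "0 \<le> (a i - a j)\<^sup>2 * elem_sym a ?R s"
    using assms by (intro mult_nonneg_nonneg elem_sym_nonneg) auto
  then show ?thesis
    unfolding diff by (simp add: power2_eq_square algebra_simps)
qed (use assms in auto)

section \<open>The inequalities of Chebyshev and Maclaurin\<close>

text \<open>Twice the difference of the two sides is the double sum of
  \<open>(a i - a j) * (b i - b j)\<close>, whose terms are all nonpositive.\<close>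

lemma Chebyshev_sum_opposite:
  fixes a b :: "'a \<Rightarrow> real"
  assumes "\<And>i j. i \<in> S \<Longrightarrow> j \<in> S \<Longrightarrow> (a i - a j) * (b i - b j) \<le> 0"
  shows "real (card S) * (\<Sum>i\<in>S. a i * b i) \<le> sum a S * sum b S"
proof -
  have "2 * (real (card S) * (\<Sum>i\<in>S. a i * b i) - sum a S * sum b S)
      = (\<Sum>i\<in>S. \<Sum>j\<in>S. a i * b i) + (\<Sum>i\<in>S. \<Sum>j\<in>S. a j * b j)
        - (\<Sum>i\<in>S. \<Sum>j\<in>S. a i * b j) - (\<Sum>i\<in>S. \<Sum>j\<in>S. a j * b i)"
    by (simp add: sum_distrib_left[symmetric] sum_distrib_right[symmetric])
  also have "\<dots> = (\<Sum>i\<in>S. \<Sum>j\<in>S. (a i - a j) * (b i - b j))"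
    unfolding sum.distrib[symmetric] sum_subtractf[symmetric]
    by (intro sum.cong refl) (simp add: algebra_simps)
  also have "\<dots> \<le> 0"
    by (intro sum_nonpos assms)
  finally show ?thesis by simp
qed

lemma Maclaurin_ineq:
  assumes "finite S" "\<And>i. i \<in> S \<Longrightarrow> 0 \<le> a i" "t \<le> card S"
  shows "elem_sym a S t / real (card S choose t) \<le> (sum a S / real (card S)) ^ t"
  using assms(3)
proof (induction t)
  case 0
  then show ?case using assms by simp
next
  case (Suc t)
  let ?n = "card S"
  define m where "m = real ?n - real t"
  have pos: "real ?n > 0" "m > 0" "real (?n choose t) > 0"
    using Suc.prems by (auto simp: m_def)
  \<comment> \<open>Chebyshev with \<open>b i = elem_sym a (S - {i}) t\<close>; the two deletion
    identities, read from right to left, turn both sides into the sums it speaks of.\<close>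
  have "real ?n * (real (Suc t) * elem_sym a S (Suc t)) \<le> sum a S * (m * elem_sym a S t)"
    unfolding m_def sum_mult_elem_sym_remove[OF assms(1), symmetric]
      sum_elem_sym_remove[OF assms(1), symmetric]
    by (intro Chebyshev_sum_opposite elem_sym_remove_opposite assms)
  then have le: "elem_sym a S (Suc t) \<le> sum a S * (m * elem_sym a S t) / (real ?n * real (Suc t))"
    using pos by (subst pos_le_divide_eq) (simp_all add: mult_ac)
  \<comment> \<open>The ratio of consecutive binomial coefficients is \<open>m / Suc t\<close>,
    which is exactly the factor in \<open>le\<close>. Hence the normalized polynomial grows by at
    most the mean of \<open>a\<close> when \<open>t\<close> increases by one.\<close>
  have "Suc t * (?n choose Suc t) = (?n - t) * (?n choose t)"
    by (simp only: binomial_absorption binomial_absorb_comp)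
  then have "real (Suc t * (?n choose Suc t)) = real ((?n - t) * (?n choose t))" by simp
  then have "real (Suc t) * real (?n choose Suc t) = m * real (?n choose t)"
    using Suc.prems by (simp add: m_def of_nat_diff distrib_right)
  then have choose: "real (?n choose Suc t) = m * real (?n choose t) / real (Suc t)"
    by (simp add: field_simps)
  have "elem_sym a S (Suc t) / real (?n choose Suc t)
      \<le> sum a S * (m * elem_sym a S t) / (real ?n * real (Suc t)) / real (?n choose Suc t)"
    by (intro divide_right_mono le) simp
  also have "\<dots> = (sum a S / real ?n) * (elem_sym a S t / real (?n choose t))"
    using pos unfolding choose by (simp add: field_simps del: of_nat_Suc)
  also have "\<dots> \<le> (sum a S / real ?n) * (sum a S / real ?n) ^ t"
    using Suc assms by (intro mult_left_mono divide_nonneg_nonneg sum_nonneg) auto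
  finally show ?case by simp
qed

section \<open>Averages over permutations of slots and over selections of strata\<close>

text \<open>
  Right translation by a permutation mapping \<open>u\<close> to \<open>K\<close> shows that the sum over \<open>\<sigma>\<close> is the same for
  every \<open>K\<close> of the size of \<open>u\<close>; the claim follows by summing over all such \<open>K\<close>.
\<close>

lemma sum_permutes_image:
  fixes h :: "'a set \<Rightarrow> real"
  assumes "finite S" "u \<subseteq> S"
  shows "real (card S choose card u) * (\<Sum>\<sigma> | \<sigma> permutes S. h (\<sigma> ` u))
       = fact (card S) * (\<Sum>K | K \<subseteq> S \<and> card K = card u. h K)"
proof -
  let ?P = "{K. K \<subseteq> S \<and> card K = card u}" and ?G = "{\<sigma>. \<sigma> permutes S}"
  have "(\<Sum>\<sigma>\<in>?G. h (\<sigma> ` K)) = (\<Sum>\<sigma>\<in>?G. h (\<sigma> ` u))" if K: "K \<in> ?P" for K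
  proof -
    have "finite u" "finite K"
      using assms K finite_subset by auto
    then obtain f where f: "bij_betw f u K"
      using K finite_same_card_bij[of u K] by auto
    have "card (S - u) = card (S - K)"
      using K assms \<open>finite u\<close> \<open>finite K\<close> by (simp add: card_Diff_subset)
    then obtain g where g: "bij_betw g (S - u) (S - K)"
      using assms finite_same_card_bij[of "S - u" "S - K"] by auto
    define \<tau> where "\<tau> = (\<lambda>x. if x \<in> u then f x else if x \<in> S then g x else x)"
    have "bij_betw \<tau> u K"
      using f by (subst bij_betw_cong[of _ _ f]) (auto simp: \<tau>_def)
    moreover have "bij_betw \<tau> (S - u) (S - K)"
      using g by (subst bij_betw_cong[of _ _ g]) (auto simp: \<tau>_def)
    ultimately have "bij_betw \<tau> (u \<union> (S - u)) (K \<union> (S - K))"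
      by (rule bij_betw_combine) blast
    moreover have im: "\<tau> ` u = K"
      using \<open>bij_betw \<tau> u K\<close> by (rule bij_betw_imp_surj_on)
    moreover have "u \<union> (S - u) = S" "K \<union> (S - K) = S" using assms K by auto
    ultimately have "\<tau> permutes S"
      using assms by (intro bij_imp_permutes) (auto simp: \<tau>_def)
    from sum_permutations_compose_right[OF this, of "\<lambda>\<sigma>. h (\<sigma> ` u)"]
    show ?thesis by (simp only: image_comp[symmetric] im)
  qed
  then have "real (card ?P) * (\<Sum>\<sigma>\<in>?G. h (\<sigma> ` u)) = (\<Sum>K\<in>?P. \<Sum>\<sigma>\<in>?G. h (\<sigma> ` K))"
    by simp
  also have "\<dots> = (\<Sum>\<sigma>\<in>?G. \<Sum>K\<in>?P. h (\<sigma> ` K))"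
    by (rule sum.swap)
  also have "\<dots> = (\<Sum>\<sigma>\<in>?G. \<Sum>K\<in>?P. h K)"
  proof (rule sum.cong[OF refl])
    fix \<sigma> assume "\<sigma> \<in> ?G"
    then have \<sigma>: "\<sigma> permutes S" by simp
    show "(\<Sum>K\<in>?P. h (\<sigma> ` K)) = (\<Sum>K\<in>?P. h K)"
    proof (rule sum.reindex_bij_witness[where i = "image (inv \<sigma>)" and j = "image \<sigma>"])
      fix K assume K: "K \<in> ?P"
      show "inv \<sigma> ` \<sigma> ` K = K" "\<sigma> ` inv \<sigma> ` K = K"
        using \<sigma> by (simp_all add: image_comp permutes_inv_o)
      show "\<sigma> ` K \<in> ?P" "inv \<sigma> ` K \<in> ?P"
        using K \<sigma> permutes_inv[OF \<sigma>]
        by (auto simp: card_image permutes_inj_on permutes_in_image)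
    qed simp
  qed
  finally show ?thesis
    using assms by (simp add: n_subsets card_permutations[OF refl])
qed

text \<open>After exchanging the sums, each \<open>t\<close>-subset \<open>T\<close> of
  \<open>S\<close> is counted once for every \<open>N\<close>-subset \<open>U\<close> containing it.
  Such \<open>U\<close> correspond to the \<open>(N - t)\<close>-subsets of \<open>S - T\<close> via
  \<open>U - T\<close>.\<close>

lemma sum_subsets_elem_sym:
  assumes "finite S" "t \<le> N" "N \<le> card S"
  shows "(\<Sum>U | U \<subseteq> S \<and> card U = N. elem_sym a U t)
       = real ((card S - t) choose (N - t)) * elem_sym a S t"
proof -
  let ?P = "\<lambda>t. {T. T \<subseteq> S \<and> card T = t}"
  have "(\<Sum>U\<in>?P N. elem_sym a U t) = (\<Sum>U\<in>?P N. \<Sum>T | T \<in> ?P t \<and> T \<subseteq> U. \<Prod>i\<in>T. a i)"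
    unfolding elem_sym_def by (intro sum.cong refl) auto
  also have "\<dots> = (\<Sum>T\<in>?P t. \<Sum>U | U \<in> ?P N \<and> T \<subseteq> U. \<Prod>i\<in>T. a i)"
    using assms by (intro sum.swap_restrict finite_subsets_card)
  also have "\<dots> = (\<Sum>T\<in>?P t. real ((card S - t) choose (N - t)) * (\<Prod>i\<in>T. a i))"
  proof (intro sum.cong refl)
    fix T assume T: "T \<in> ?P t"
    then have "finite T" using assms finite_subset by auto
    have fin: "finite U" if "U \<subseteq> S" for U using that assms finite_subset by auto
    have "bij_betw (\<lambda>U. U - T) {U. U \<in> ?P N \<and> T \<subseteq> U} {V. V \<subseteq> S - T \<and> card V = N - t}"
    proof (rule bij_betw_byWitness[where f' = "\<lambda>V. V \<union> T"])
      show "(\<lambda>U. U - T) ` {U. U \<in> ?P N \<and> T \<subseteq> U} \<subseteq> {V. V \<subseteq> S - T \<and> card V = N - t}"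
        using T \<open>finite T\<close> by (auto simp: card_Diff_subset)
      show "(\<lambda>V. V \<union> T) ` {V. V \<subseteq> S - T \<and> card V = N - t} \<subseteq> {U. U \<in> ?P N \<and> T \<subseteq> U}"
      proof clarsimp
        fix V assume V: "V \<subseteq> S - T" "card V = N - t"
        then have "card (V \<union> T) = card V + card T"
          using fin[of V] \<open>finite T\<close> by (intro card_Un_disjoint) auto
        then show "V \<subseteq> S \<and> T \<subseteq> S \<and> card (V \<union> T) = N"
          using V T assms by auto
      qed
    qed auto
    then have "card {U. U \<in> ?P N \<and> T \<subseteq> U} = (card S - t) choose (N - t)"
      using T \<open>finite T\<close> assms
      by (simp add: bij_betw_same_card n_subsets card_Diff_subset)
    then show "(\<Sum>U | U \<in> ?P N \<and> T \<subseteq> U. \<Prod>i\<in>T. a i)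
        = real ((card S - t) choose (N - t)) * (\<Prod>i\<in>T. a i)"
      by simp
  qed
  finally show ?thesis by (simp add: elem_sym_def sum_distrib_left)
qed

text \<open>Turns sums over 0-1 vectors into sums over \<open>N\<close>-subsets. The inverse is the
  indicator vector, restricted to \<open>{1..\<beta>}\<close> because the vectors in
  \<open>selections\<close> are extensional, that is \<open>undefined\<close> elsewhere.\<close>

lemma bij_betw_selected:
  "bij_betw (selected \<beta>) (selections \<beta> N) {U. U \<subseteq> {1..\<beta>} \<and> card U = N}"
proof (rule bij_betw_byWitness[where
      f' = "\<lambda>U. \<lambda>j\<in>{1..\<beta>}. if j \<in> U then 1 else 0"])
  have card: "card (selected \<beta> v) = (\<Sum>j\<in>{1..\<beta>}. v j)" if "v \<in> {1..\<beta>} \<rightarrow>\<^sub>E {0, 1}" for v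
  proof -
    have "(\<Sum>j\<in>{1..\<beta>}. v j) = (\<Sum>j\<in>{1..\<beta>}. if v j = 1 then 1 else 0)"
      using that by (intro sum.cong refl) (auto simp: PiE_iff)
    then show ?thesis by (simp add: selected_def sum.If_cases Int_def)
  qed
  show "selected \<beta> ` selections \<beta> N \<subseteq> {U. U \<subseteq> {1..\<beta>} \<and> card U = N}"
    by (auto simp: selections_def card) (auto simp: selected_def)
  show "(\<lambda>U. \<lambda>j\<in>{1..\<beta>}. if j \<in> U then 1 else 0) ` {U. U \<subseteq> {1..\<beta>} \<and> card U = N}
      \<subseteq> selections \<beta> N"
    by (auto simp: selections_def sum.If_cases Int_absorb1 split: if_splits)
  show "\<forall>v\<in>selections \<beta> N. (\<lambda>j\<in>{1..\<beta>}. if j \<in> selected \<beta> v then 1 else 0) = v"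
    by (auto simp: selections_def selected_def fun_eq_iff PiE_iff extensional_def)
  show "\<forall>U\<in>{U. U \<subseteq> {1..\<beta>} \<and> card U = N}.
      selected \<beta> (\<lambda>j\<in>{1..\<beta>}. if j \<in> U then 1 else 0) = U"
    by (auto simp: selected_def split: if_splits)
qed

lemma bij_betw_nth_selected:
  assumes "v \<in> selections \<beta> N"
  shows "bij_betw (nth_selected \<beta> v) {1..N} (selected \<beta> v)"
proof -
  have fin: "finite (selected \<beta> v)" by (simp add: selected_def)
  have card: "card (selected \<beta> v) = N"
    using bij_betwE[OF bij_betw_selected] assms by blast
  have "bij_betw ((!) (sorted_list_of_set (selected \<beta> v))) {..<N} (selected \<beta> v)"
    using fin card by (intro bij_betw_nth) auto
  \<comment> \<open>Slots are numbered from 1 but list positions from 0.\<close>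
  moreover have "bij_betw (\<lambda>k. k - 1) {1..N} {..<N}"
    by (rule bij_betw_byWitness[where f' = Suc]) auto
  ultimately have "bij_betw ((!) (sorted_list_of_set (selected \<beta> v)) \<circ> (\<lambda>k. k - 1)) {1..N} (selected \<beta> v)"
    using bij_betw_trans by blast
  then show ?thesis
    by (simp add: nth_selected_def comp_def cong: bij_betw_cong)
qed

lemma mean_over_selections_and_permutations:
  assumes "N \<le> \<beta>" "u \<subseteq> {1..N}"
  shows "(\<Sum>\<sigma> | \<sigma> permutes {1..N}. \<Sum>v\<in>selections \<beta> N. \<Prod>k\<in>\<sigma> ` u. a (nth_selected \<beta> v k))
      / (fact N * real (card (selections \<beta> N)))
    = elem_sym a {1..\<beta>} (card u) / real (\<beta> choose card u)"
proof -
  let ?t = "card u"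
  let ?h = "\<lambda>v K. \<Prod>k\<in>K. a (nth_selected \<beta> v k)"
  have t: "?t \<le> N" using card_mono[OF _ assms(2)] by simp
  \<comment> \<open>For a fixed selection, numbering is injective, so sets of slots correspond to
    sets of selected strata of the same size.\<close>
  have sel: "(\<Sum>K | K \<subseteq> {1..N} \<and> card K = ?t. ?h v K) = elem_sym a (selected \<beta> v) ?t"
    if "v \<in> selections \<beta> N" for v
  proof -
    note bij = bij_betw_nth_selected[OF that]
    have inj: "inj_on (nth_selected \<beta> v) K" if "K \<subseteq> {1..N}" for K
      using bij that inj_on_subset by (auto simp: bij_betw_def)
    have im: "bij_betw (image (nth_selected \<beta> v)) {K. K \<subseteq> {1..N} \<and> card K = ?t}
        {T. T \<subseteq> selected \<beta> v \<and> card T = ?t}"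
    proof -
      have "bij_betw (image (nth_selected \<beta> v)) (Pow {1..N}) (Pow (selected \<beta> v))"
        using bij by (rule bij_betw_Pow)
      from bij_betw_subset[OF this, of "{K. K \<subseteq> {1..N} \<and> card K = ?t}"]
      have "bij_betw (image (nth_selected \<beta> v)) {K. K \<subseteq> {1..N} \<and> card K = ?t}
          (image (nth_selected \<beta> v) ` {K. K \<subseteq> {1..N} \<and> card K = ?t})" by auto
      moreover have "image (nth_selected \<beta> v) ` {K. K \<subseteq> {1..N} \<and> card K = ?t}
          = {T. T \<subseteq> selected \<beta> v \<and> card T = ?t}"
      proof (intro set_eqI iffI)
        fix T assume "T \<in> {T. T \<subseteq> selected \<beta> v \<and> card T = ?t}"
        moreover from this obtain K where "K \<subseteq> {1..N}" "T = nth_selected \<beta> v ` K"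
          using bij by (metis (no_types, lifting) bij_betw_imp_surj_on mem_Collect_eq subset_imageE)
        ultimately show "T \<in> image (nth_selected \<beta> v) ` {K. K \<subseteq> {1..N} \<and> card K = ?t}"
          using inj by (auto simp: card_image)
      next
        fix T assume "T \<in> image (nth_selected \<beta> v) ` {K. K \<subseteq> {1..N} \<and> card K = ?t}"
        then show "T \<in> {T. T \<subseteq> selected \<beta> v \<and> card T = ?t}"
          using bij inj by (auto simp: card_image bij_betw_def)
      qed
      ultimately show ?thesis by simp
    qed
    show ?thesis
      unfolding elem_sym_def sum.reindex_bij_betw[OF im, symmetric]
      by (intro sum.cong refl) (auto simp: prod.reindex inj)
  qed
  have "real (N choose ?t) * (\<Sum>\<sigma> | \<sigma> permutes {1..N}. \<Sum>v\<in>selections \<beta> N. ?h v (\<sigma> ` u))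
      = (\<Sum>v\<in>selections \<beta> N. real (N choose ?t) * (\<Sum>\<sigma> | \<sigma> permutes {1..N}. ?h v (\<sigma> ` u)))"
    by (subst sum.swap) (simp add: sum_distrib_left)
  also have "\<dots> = (\<Sum>v\<in>selections \<beta> N. fact N * elem_sym a (selected \<beta> v) ?t)"
    using sum_permutes_image[OF _ assms(2)] sel by (intro sum.cong refl) auto
  also have "\<dots> = fact N * (\<Sum>U | U \<subseteq> {1..\<beta>} \<and> card U = N. elem_sym a U ?t)"
    by (subst sum.reindex_bij_betw[OF bij_betw_selected, symmetric]) (simp add: sum_distrib_left)
  also have "\<dots> = fact N * (real ((\<beta> - ?t) choose (N - ?t)) * elem_sym a {1..\<beta>} ?t)"
    using assms t by (subst sum_subsets_elem_sym) auto
  finally have main: "real (N choose ?t) * (\<Sum>\<sigma> | \<sigma> permutes {1..N}. \<Sum>v\<in>selections \<beta> N. ?h v (\<sigma> ` u))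
      = fact N * (real ((\<beta> - ?t) choose (N - ?t)) * elem_sym a {1..\<beta>} ?t)" (is "?x * ?Q = fact N * (?y * ?e)") .
  have c: "card (selections \<beta> N) = \<beta> choose N"
    using bij_betw_same_card[OF bij_betw_selected[of \<beta> N]] by (simp add: n_subsets)
  \<comment> \<open>Both sides count the pairs of a \<open>?t\<close>-subset inside an
    \<open>N\<close>-subset of the strata.\<close>
  have ch: "real (\<beta> choose N) * ?x = real (\<beta> choose ?t) * ?y"
    using choose_mult[OF t assms(1)] by (metis of_nat_mult)
  have pos: "?x > 0" "?y > 0" "real (\<beta> choose N) > 0" "real (\<beta> choose ?t) > 0"
    using t assms by auto
  have "?Q = fact N * ?y * ?e / ?x"
    using main pos by (simp add: field_simps)
  then have "?Q / (fact N * real (\<beta> choose N)) = ?y * ?e / (real (\<beta> choose N) * ?x)"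
    by simp
  also have "\<dots> = ?e / real (\<beta> choose ?t)"
    using pos unfolding ch by simp
  finally show ?thesis by (simp add: c)
qed

section \<open>The law of the sampled points\<close>

text \<open>An exact formula, obtained by splitting the event according to the value of
  \<open>\<pi>\<close> and, for each set of slots, according to the value of
  \<open>Y\<close>.\<close>

lemma prob_stratified_points:
  fixes p :: "nat \<Rightarrow> 'o \<Rightarrow> real ^ 'd"
  assumes "N \<le> \<beta>" "generalized_stratified_sampling M N \<beta> B p"
    and A: "A \<in> sets lebesgue" and u: "u \<subseteq> {1..N}"
  shows "measure M {\<omega> \<in> space M. \<forall>j\<in>u. p j \<omega> \<in> A}
    = elem_sym (\<lambda>i. measure (uniform_measure lebesgue (B i)) A) {1..\<beta>} (card u)
      / real (\<beta> choose card u)"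
proof -
  let ?a = "\<lambda>i. measure (uniform_measure lebesgue (B i)) A"
  let ?V = "selections \<beta> N" and ?G = "{\<sigma>. \<sigma> permutes {1..N}}"
  from assms(2) interpret prob_space M
    by (simp add: generalized_stratified_sampling_def)
  from assms(2) obtain Y X \<pi> where
    Y: "Y \<in> measurable M (count_space ?V)"
      "distr M (count_space ?V) Y = uniform_count_measure ?V"
    and X: "\<forall>j\<in>{1..\<beta>}. X j \<in> measurable M lebesgue"
    and points: "\<forall>v\<in>?V. prob_space.indep_vars
        (uniform_measure M {\<omega> \<in> space M. Y \<omega> = v}) (\<lambda>_. lebesgue) X (selected \<beta> v) \<and>
      (\<forall>j\<in>selected \<beta> v. distr (uniform_measure M {\<omega> \<in> space M. Y \<omega> = v}) lebesgue (X j)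
          = uniform_measure lebesgue (B j))"
    and \<pi>: "\<pi> \<in> measurable M (count_space ?G)"
      "distr M (count_space ?G) \<pi> = uniform_count_measure ?G"
    and indep_\<pi>: "indep_set (sets (vimage_algebra (space M) \<pi> (count_space ?G)))
        (sets (vimage_algebra (space M)
          (\<lambda>\<omega>. (Y \<omega>, \<lambda>k\<in>{1..N}. X (nth_selected \<beta> (Y \<omega>) k) \<omega>))
          (count_space ?V \<Otimes>\<^sub>M (\<Pi>\<^sub>M k\<in>{1..N}. lebesgue))))"
    and p: "\<forall>k\<in>{1..N}. \<forall>\<omega>\<in>space M. p k \<omega> = X (nth_selected \<beta> (Y \<omega>) (\<pi> \<omega> k)) \<omega>"
    unfolding generalized_stratified_sampling_def Let_def
    by (elim conjE exE) (rule that)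
  define q where "q = (\<lambda>k \<omega>. X (nth_selected \<beta> (Y \<omega>) k) \<omega>)"
  note Y(1)[measurable] \<pi>(1)[measurable] A[measurable]
  have finV: "finite ?V" and V: "?V \<noteq> {}"
  proof -
    have "card ?V = \<beta> choose N"
      using bij_betw_same_card[OF bij_betw_selected[of \<beta> N]] by (simp add: n_subsets)
    then have "card ?V > 0" using assms(1) by simp
    then show "finite ?V" "?V \<noteq> {}" by (simp_all add: card_gt_0_iff)
  qed
  have finG: "finite ?G" by (simp add: finite_permutations)
  have mem: "Y \<omega> \<in> ?V" "\<pi> \<omega> \<in> ?G" if "\<omega> \<in> space M" for \<omega>
    using measurable_space[OF Y(1) that] measurable_space[OF \<pi>(1) that] by simp_all
  have [measurable]: "{\<omega> \<in> space M. Y \<omega> = v} \<in> events" if "v \<in> ?V" for v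
    using measurable_sets[OF Y(1), of "{v}"] that by (simp add: vimage_def Int_def conj_commute)
  have probY: "prob {\<omega> \<in> space M. Y \<omega> = v} = 1 / real (card ?V)" if "v \<in> ?V" for v
  proof -
    have "measure (distr M (count_space ?V) Y) {v} = prob (Y -` {v} \<inter> space M)"
      using that Y(1) by (subst measure_distr) auto
    then show ?thesis
      using that finV unfolding Y(2)
      by (simp add: measure_uniform_count_measure vimage_def Int_def conj_commute)
  qed
  have prob\<pi>: "prob {\<omega> \<in> space M. \<pi> \<omega> = \<sigma>} = 1 / fact N" if "\<sigma> \<in> ?G" for \<sigma>
  proof -
    have "measure (distr M (count_space ?G) \<pi>) {\<sigma>} = prob (\<pi> -` {\<sigma>} \<inter> space M)"
      using that \<pi>(1) by (subst measure_distr) auto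
    then show ?thesis
      using that finG unfolding \<pi>(2)
      by (simp add: measure_uniform_count_measure vimage_def Int_def conj_commute
          card_permutations[OF refl])
  qed

  \<comment> \<open>On \<open>Y = v\<close>, distinct slots hold the points of distinct selected
    strata. These are independent under the conditional measure, which gives the product; the
    divisor comes from the probability of \<open>Y = v\<close>.\<close>
  have given_Y: "prob {\<omega> \<in> space M. Y \<omega> = v \<and> (\<forall>k\<in>K. q k \<omega> \<in> A)}
      = (\<Prod>k\<in>K. ?a (nth_selected \<beta> v k)) / real (card ?V)"
    if v: "v \<in> ?V" and K: "K \<subseteq> {1..N}" for v K
  proof -
    let ?E = "{\<omega> \<in> space M. Y \<omega> = v}"
    let ?J = "nth_selected \<beta> v ` K"
    have E: "emeasure M ?E \<noteq> 0" "emeasure M ?E \<noteq> \<infinity>"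
      using probY[OF v] finV V by (auto simp: emeasure_eq_measure)
    interpret v: prob_space "uniform_measure M ?E"
      using E by (rule prob_space_uniform_measure)
    have sel: "?J \<subseteq> selected \<beta> v" "inj_on (nth_selected \<beta> v) K"
      using bij_betw_nth_selected[OF v] K by (auto simp: bij_betw_def intro: inj_on_subset)
    have J: "finite ?J" "?J \<subseteq> {1..\<beta>}"
      using sel K finite_subset[OF K] by (auto simp: selected_def)
    have evX: "{\<omega> \<in> space M. \<forall>i\<in>?J. X i \<omega> \<in> A} \<in> events"
      using J X A by (intro sets.sets_Collect_finite_All) (auto intro!: measurable_sets_Collect[of _ M lebesgue])
    have "prob {\<omega> \<in> space M. Y \<omega> = v \<and> (\<forall>k\<in>K. q k \<omega> \<in> A)}
        = prob (?E \<inter> {\<omega> \<in> space M. \<forall>i\<in>?J. X i \<omega> \<in> A})"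
      by (intro arg_cong[where f = prob]) (auto simp: q_def)
    also have "\<dots> = prob ?E * v.prob {\<omega> \<in> space M. \<forall>i\<in>?J. X i \<omega> \<in> A}"
      using probY[OF v] finV V by (simp only: measure_uniform_measure[OF E evX]) simp
    also have "v.prob {\<omega> \<in> space M. \<forall>i\<in>?J. X i \<omega> \<in> A} = (\<Prod>i\<in>?J. ?a i)"
    \<comment> \<open>The product rule \<open>indep_varsD\<close> is applied to a nonempty index
      set; for an empty one both sides are 1.\<close>
    proof (cases "?J = {}")
      case True
      then show ?thesis using v.prob_space by simp
    next
      case False
      have "{\<omega> \<in> space M. \<forall>i\<in>?J. X i \<omega> \<in> A}
          = (\<Inter>i\<in>?J. X i -` A \<inter> space (uniform_measure M ?E))"
        using False by auto
      moreover have "v.prob (X i -` A \<inter> space (uniform_measure M ?E)) = ?a i" if "i \<in> ?J" for i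
      proof -
        have i: "i \<in> selected \<beta> v" "i \<in> {1..\<beta>}" using that sel J by blast+
        have "measure (distr (uniform_measure M ?E) lebesgue (X i)) A
            = v.prob (X i -` A \<inter> space (uniform_measure M ?E))"
          using X i(2) A
          by (intro measure_distr) (simp_all add: measurable_cong_sets[OF sets_uniform_measure refl])
        then show ?thesis using points v i by simp
      qed
      ultimately show ?thesis
        using v.indep_varsD[OF bspec[OF points v, THEN conjunct1] False J(1) sel(1), of "\<lambda>_. A"] A by simp
    qed
    finally show ?thesis
      using sel(2) by (simp add: probY[OF v] prod.reindex)
  qed

  \<comment> \<open>Independence from \<open>\<pi>\<close> is available only for events in the
    sigma-algebra generated by \<open>Y\<close> and the unsymmetrized points, so membership there is
    required, not just in \<open>events\<close>.\<close>
  have meas_q: "{\<omega> \<in> space M. \<forall>k\<in>K. q k \<omega> \<in> A} \<in>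
      sets (vimage_algebra (space M) (\<lambda>\<omega>. (Y \<omega>, \<lambda>k\<in>{1..N}. X (nth_selected \<beta> (Y \<omega>) k) \<omega>))
          (count_space ?V \<Otimes>\<^sub>M (\<Pi>\<^sub>M k\<in>{1..N}. lebesgue)))" (is "_ \<in> sets ?F")
    if K: "K \<subseteq> {1..N}" for K
  proof -
    \<comment> \<open>The event as a preimage of a rectangle that leaves \<open>Y\<close> and the
      slots outside \<open>K\<close> unconstrained.\<close>
    have "?V \<times> (\<Pi>\<^sub>E k\<in>{1..N}. if k \<in> K then A else UNIV)
        \<in> sets (count_space ?V \<Otimes>\<^sub>M (\<Pi>\<^sub>M k\<in>{1..N}. lebesgue))" (is "?D \<in> _")
      using A by (intro pair_measureI sets_PiM_I_finite) auto
    then have "(\<lambda>\<omega>. (Y \<omega>, \<lambda>k\<in>{1..N}. X (nth_selected \<beta> (Y \<omega>) k) \<omega>)) -` ?D \<inter> space M \<in> sets ?F"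
      by (rule in_vimage_algebra)
    also have "(\<lambda>\<omega>. (Y \<omega>, \<lambda>k\<in>{1..N}. X (nth_selected \<beta> (Y \<omega>) k) \<omega>)) -` ?D \<inter> space M
        = {\<omega> \<in> space M. \<forall>k\<in>K. q k \<omega> \<in> A}"
      using K mem(1) by (auto simp: q_def PiE_iff split: if_splits)
    finally show ?thesis .
  qed
  \<comment> \<open>\<open>indep_set\<close> includes that the generated sigma-algebra lies in
    \<open>events\<close>.\<close>
  have ev_q: "{\<omega> \<in> space M. \<forall>k\<in>K. q k \<omega> \<in> A} \<in> events" if "K \<subseteq> {1..N}" for K
    using meas_q[OF that] indep_setD_ev2[OF indep_\<pi>] by blast
  have ev_Yq: "{\<omega> \<in> space M. Y \<omega> = v \<and> (\<forall>k\<in>K. q k \<omega> \<in> A)} \<in> events"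
    if "v \<in> ?V" "K \<subseteq> {1..N}" for v K
  proof -
    have "{\<omega> \<in> space M. Y \<omega> = v \<and> (\<forall>k\<in>K. q k \<omega> \<in> A)}
        = {\<omega> \<in> space M. Y \<omega> = v} \<inter> {\<omega> \<in> space M. \<forall>k\<in>K. q k \<omega> \<in> A}" by auto
    then show ?thesis using ev_q that by auto
  qed
  have prob_q: "prob {\<omega> \<in> space M. \<forall>k\<in>K. q k \<omega> \<in> A}
      = (\<Sum>v\<in>?V. \<Prod>k\<in>K. ?a (nth_selected \<beta> v k)) / real (card ?V)"
    if K: "K \<subseteq> {1..N}" for K
  proof -
    have "{\<omega> \<in> space M. \<forall>k\<in>K. q k \<omega> \<in> A}
        = (\<Union>v\<in>?V. {\<omega> \<in> space M. Y \<omega> = v \<and> (\<forall>k\<in>K. q k \<omega> \<in> A)})"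
      using mem(1) by auto
    also have "prob \<dots> = (\<Sum>v\<in>?V. prob {\<omega> \<in> space M. Y \<omega> = v \<and> (\<forall>k\<in>K. q k \<omega> \<in> A)})"
      using finV ev_Yq K by (intro finite_measure_finite_Union) (auto simp: disjoint_family_on_def)
    finally show ?thesis
      using given_Y K by (simp add: sum_divide_distrib)
  qed
  have given_\<pi>: "{\<omega> \<in> space M. \<pi> \<omega> = \<sigma> \<and> (\<forall>j\<in>u. p j \<omega> \<in> A)} \<in> events"
    "prob {\<omega> \<in> space M. \<pi> \<omega> = \<sigma> \<and> (\<forall>j\<in>u. p j \<omega> \<in> A)}
      = 1 / fact N * ((\<Sum>v\<in>?V. \<Prod>k\<in>\<sigma> ` u. ?a (nth_selected \<beta> v k)) / real (card ?V))"
    if \<sigma>: "\<sigma> \<in> ?G" for \<sigma>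
  proof -
    have K: "\<sigma> ` u \<subseteq> {1..N}"
      using \<sigma> u permutes_image[of \<sigma> "{1..N}"] by auto
    have eq: "{\<omega> \<in> space M. \<pi> \<omega> = \<sigma> \<and> (\<forall>j\<in>u. p j \<omega> \<in> A)}
        = {\<omega> \<in> space M. \<pi> \<omega> = \<sigma>} \<inter> {\<omega> \<in> space M. \<forall>k\<in>\<sigma> ` u. q k \<omega> \<in> A}"
      using p u by (auto simp: q_def subset_iff)
    have \<pi>_ev: "{\<omega> \<in> space M. \<pi> \<omega> = \<sigma>} \<in> sets (vimage_algebra (space M) \<pi> (count_space ?G))"
      using in_vimage_algebra[of "{\<sigma>}" "count_space ?G" \<pi> "space M"] \<sigma>
      by (simp add: vimage_def Int_def conj_commute)
    show "{\<omega> \<in> space M. \<pi> \<omega> = \<sigma> \<and> (\<forall>j\<in>u. p j \<omega> \<in> A)} \<in> events"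
      unfolding eq using \<pi>_ev indep_setD_ev1[OF indep_\<pi>] ev_q[OF K] by blast
    show "prob {\<omega> \<in> space M. \<pi> \<omega> = \<sigma> \<and> (\<forall>j\<in>u. p j \<omega> \<in> A)}
      = 1 / fact N * ((\<Sum>v\<in>?V. \<Prod>k\<in>\<sigma> ` u. ?a (nth_selected \<beta> v k)) / real (card ?V))"
      unfolding eq indep_setD[OF indep_\<pi> \<pi>_ev meas_q[OF K]] prob\<pi>[OF \<sigma>] prob_q[OF K] ..
  qed
  have "{\<omega> \<in> space M. \<forall>j\<in>u. p j \<omega> \<in> A}
      = (\<Union>\<sigma>\<in>?G. {\<omega> \<in> space M. \<pi> \<omega> = \<sigma> \<and> (\<forall>j\<in>u. p j \<omega> \<in> A)})"
    using mem(2) by auto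
  also have "prob \<dots> = (\<Sum>\<sigma>\<in>?G. prob {\<omega> \<in> space M. \<pi> \<omega> = \<sigma> \<and> (\<forall>j\<in>u. p j \<omega> \<in> A)})"
    using finG given_\<pi>(1) by (intro finite_measure_finite_Union) (auto simp: disjoint_family_on_def)
  also have "\<dots> = (\<Sum>\<sigma>\<in>?G. \<Sum>v\<in>?V. \<Prod>k\<in>\<sigma> ` u. ?a (nth_selected \<beta> v k))
      / (fact N * real (card ?V))"
    using given_\<pi>(2) by (simp add: sum_divide_distrib mult.commute)
  finally show ?thesis
    using mean_over_selections_and_permutations[OF assms(1) u, of ?a] by simp
qed

section \<open>Negative dependence\<close>

text \<open>The exact formula for singletons shows that every factor on the right is the mean of
  \<open>?a\<close>, so the product is the power in Maclaurin's inequality.\<close>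

lemma stratified_points_negatively_correlated:
  fixes p :: "nat \<Rightarrow> 'o \<Rightarrow> real ^ 'd"
  assumes "N \<le> \<beta>" "generalized_stratified_sampling M N \<beta> B p"
    and "A \<in> sets lebesgue" "u \<subseteq> {1..N}"
  shows "measure M {\<omega> \<in> space M. \<forall>j\<in>u. p j \<omega> \<in> A}
    \<le> (\<Prod>j\<in>u. measure M {\<omega> \<in> space M. p j \<omega> \<in> A})"
proof -
  let ?a = "\<lambda>i. measure (uniform_measure lebesgue (B i)) A"
  have "card u \<le> \<beta>"
    using card_mono[OF _ assms(4)] assms(1) by simp
  have "measure M {\<omega> \<in> space M. p j \<omega> \<in> A} = sum ?a {1..\<beta>} / real \<beta>" if "j \<in> u" for j
    using prob_stratified_points[OF assms(1-3), of "{j}"] that assms(4) elem_sym_1[of "{1..\<beta>}" ?a]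
    by auto
  then have "(\<Prod>j\<in>u. measure M {\<omega> \<in> space M. p j \<omega> \<in> A}) = (sum ?a {1..\<beta>} / real \<beta>) ^ card u"
    by simp
  then show ?thesis
    using prob_stratified_points[OF assms] Maclaurin_ineq[of "{1..\<beta>}" ?a "card u"] \<open>card u \<le> \<beta>\<close>
    by simp
qed

theorem theorem4p4:
  fixes M :: "'o measure"
    and N \<beta> :: nat
    and B :: "nat \<Rightarrow> (real ^ 'd) set"
    and p :: "nat \<Rightarrow> 'o \<Rightarrow> real ^ 'd"
  assumes "\<beta> \<ge> N"
    and "equal_volume_partition \<beta> B"
    and "generalized_stratified_sampling M N \<beta> B p"
  shows "(\<forall>A. A \<in> sets lebesgue \<and> A \<subseteq> half_open_cube \<longrightarrow>
            (\<forall>t. 1 \<le> t \<and> t \<le> N \<longrightarrow>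
               measure M {\<omega> \<in> space M. \<forall>j\<in>{1..t}. p j \<omega> \<in> A}
                 \<le> (\<Prod>j\<in>{1..t}. measure M {\<omega> \<in> space M. p j \<omega> \<in> A}))) \<and>
         (\<forall>\<S>. \<S> \<subseteq> {Q \<in> sets lebesgue. Q \<subseteq> half_open_cube} \<longrightarrow>
            negatively_dependent M \<S> N p)"
proof (intro conjI allI impI)
  note le = stratified_points_negatively_correlated[OF assms(1,3)]
  fix A :: "(real ^ 'd) set" and t
  assume "A \<in> sets lebesgue \<and> A \<subseteq> half_open_cube" "1 \<le> t \<and> t \<le> N"
  then show "measure M {\<omega> \<in> space M. \<forall>j\<in>{1..t}. p j \<omega> \<in> A}
      \<le> (\<Prod>j\<in>{1..t}. measure M {\<omega> \<in> space M. p j \<omega> \<in> A})"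
    by (intro le) auto
next
  note le = stratified_points_negatively_correlated[OF assms(1,3)]
  fix \<S> :: "(real ^ 'd) set set"
  assume \<S>: "\<S> \<subseteq> {Q \<in> sets lebesgue. Q \<subseteq> half_open_cube}"
  show "negatively_dependent M \<S> N p"
    unfolding negatively_dependent_def Let_def
  proof (intro ballI allI impI)
    fix Q u
    assume Q: "Q \<in> \<S>" and u: "u \<subseteq> {1..N}"
    have "Q \<in> sets lebesgue" using Q \<S> by auto
    \<comment> \<open>This complement is taken in the whole space and leaves the cube;
      \<open>le\<close> asks only for Lebesgue measurability.\<close>
    then have "- Q \<in> sets lebesgue" by (rule Compl_in_sets_lebesgue[THEN iffD2])
    have "indicator Q x = (1::real) \<longleftrightarrow> x \<in> Q" "indicator Q x = (0::real) \<longleftrightarrow> x \<in> - Q" for x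
      by (auto simp: indicator_def)
    then show "measure M {\<omega> \<in> space M. \<forall>j\<in>u. indicator Q (p j \<omega>) = (1::real)}
          \<le> (\<Prod>j\<in>u. measure M {\<omega> \<in> space M. indicator Q (p j \<omega>) = (1::real)}) \<and>
        measure M {\<omega> \<in> space M. \<forall>j\<in>u. indicator Q (p j \<omega>) = (0::real)}
          \<le> (\<Prod>j\<in>u. measure M {\<omega> \<in> space M. indicator Q (p j \<omega>) = (0::real)})"
      using le[OF \<open>Q \<in> sets lebesgue\<close> u] le[OF \<open>- Q \<in> sets lebesgue\<close> u] by simp
  qed
qed

end
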